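(* Let $r\ge 1$ be an integer, let $\alpha_1,\ldots,\alpha_r>-1$ be real with $\alpha_i-\alpha_j\notin\mathbb{Z}$ for $i\neq j$, and let $q_1,\ldots,q_r>0$ be real with $q_1+\cdots+q_r=1$. For $n\in\mathbb{N}$ put $\vec{n}=(n_1,\ldots,n_r)$ with $n_j=\lfloor q_j n\rfloor$, and $|\vec{n}|=n_1+\cdots+n_r$ (so that $|\vec{n}|/n\to 1$ as $n\to\infty$). Let $L^{[1]}_{\vec{n}}$ be the multiple Laguerre polynomial of the first kind with multi-index $\vec{n}$ and parameters $\alpha_1,\ldots,\alpha_r$. Then \[ \lim_{n\to\infty}(-1)^{|\vec{n}|}\frac{L^{[1]}_{\vec{n}}(z/n^r)}{\prod_{j=1}^r(\alpha_j+1)_{n_j}}={}_0F_r(-;\alpha_1+1,\ldots,\alpha_r+1;-(q_1\cdots q_r)z), \] uniformly for $z$ in compact subsets of $\mathbb{C}$.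
   Context: Notation: $(a)_k=a(a+1)\cdots(a+k-1)$, $(a)_0=1$, is the Pochhammer symbol, and ${}_0F_r(-;b_1,\ldots,b_r;z)=\sum_{k=0}^\infty \frac{z^k}{(b_1)_k\cdots(b_r)_k\,k!}$. The multiple Laguerre polynomial of the first kind $L^{[1]}_{\vec{n}}$, for a multi-index $\vec{n}=(n_1,\ldots,n_r)$ of nonnegative integers, is the polynomial of degree $|\vec{n}|$ defined by the Rodrigues formula (for $x>0$) \[ (-1)^{|\vec{n}|}e^{-x}L^{[1]}_{\vec{n}}(x)=\prod_{j=1}^r\left(x^{-\alpha_j}\frac{d^{n_j}}{dx^{n_j}}x^{n_j+\alpha_j}\right)e^{-x}, \] where the product on the right is a product (composition) of differential operators (which commute), each consisting of multiplication by $x^{n_j+\alpha_j}$, then differentiating $n_j$ times, then multiplication by $x^{-\alpha_j}$, all applied to $e^{-x}$. These polynomials satisfy $\int_0^\infty L^{[1]}_{\vec{n}}(x)x^kx^{\alpha_j}e^{-x}\,dx=0$ for $0\le k\le n_j-1$, $1\le j\le r$. *)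

theory Defs
  imports "HOL-Analysis.Analysis" "HOL-Computational_Algebra.Polynomial"
begin

text \<open>Functions are total on the reals, but only their values at \<open>x > 0\<close> are meaningful: there
  \<^const>\<open>powr\<close> is the usual real power, and differentiation is local.\<close>

definition rodrigues_factor :: "real \<Rightarrow> nat \<Rightarrow> (real \<Rightarrow> real) \<Rightarrow> real \<Rightarrow> real" where
  "rodrigues_factor a m f =
     (\<lambda>x. x powr (- a) * (deriv ^^ m) (\<lambda>t. t powr (real m + a) * f t) x)"

definition rodrigues_op ::
  "nat \<Rightarrow> (nat \<Rightarrow> real) \<Rightarrow> (nat \<Rightarrow> nat) \<Rightarrow> (real \<Rightarrow> real) \<Rightarrow> real \<Rightarrow> real" where
  "rodrigues_op r \<alpha> m = foldr (\<lambda>j. rodrigues_factor (\<alpha> j) (m j)) [1..<Suc r]"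

definition is_mult_laguerre1 ::
  "nat \<Rightarrow> (nat \<Rightarrow> real) \<Rightarrow> (nat \<Rightarrow> nat) \<Rightarrow> real poly \<Rightarrow> bool" where
  "is_mult_laguerre1 r \<alpha> m P \<longleftrightarrow>
     degree P = (\<Sum>j=1..r. m j) \<and>
     (\<forall>x>0. (-1) ^ (\<Sum>j=1..r. m j) * exp (- x) * poly P x =
            rodrigues_op r \<alpha> m (\<lambda>t. exp (- t)) x)"

definition mult_laguerre1 :: "nat \<Rightarrow> (nat \<Rightarrow> real) \<Rightarrow> (nat \<Rightarrow> nat) \<Rightarrow> real poly" where
  "mult_laguerre1 r \<alpha> m = (THE P. is_mult_laguerre1 r \<alpha> m P)"

definition hypergeom_0F :: "nat \<Rightarrow> (nat \<Rightarrow> complex) \<Rightarrow> complex \<Rightarrow> complex" where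
  "hypergeom_0F r b z = (\<Sum>k. z ^ k / ((\<Prod>j=1..r. pochhammer (b j) k) * fact k))"

text \<open>Existence and uniqueness of the polynomial in the Rodrigues formula, so that the definite
  description above denotes it.\<close>

lemma deriv_funpow_cong_pos:
  fixes f g :: "real \<Rightarrow> real"
  assumes "\<And>x. x > 0 \<Longrightarrow> f x = g x" and "x > 0"
  shows "(deriv ^^ m) f x = (deriv ^^ m) g x"
  using assms(2)
proof (induction m arbitrary: x)
  case 0
  then show ?case using assms(1) by simp
next
  case (Suc m)
  have "eventually (\<lambda>y. y > 0) (nhds x)"
    using Suc.prems eventually_nhds_in_open[of "{0<..}" x] by simp
  then have "eventually (\<lambda>y. (deriv ^^ m) f y = (deriv ^^ m) g y) (nhds x)"
    by (rule eventually_mono) (use Suc.IH in simp)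
  then show ?case
    by (simp add: deriv_cong_ev)
qed

lemma rodrigues_factor_poly_exp:
  fixes p :: "real poly"
  assumes "p \<noteq> 0" and "\<And>x. x > 0 \<Longrightarrow> f x = poly p x * exp (- x)"
  shows "\<exists>q. q \<noteq> 0 \<and> degree q = degree p + m \<and>
           (\<forall>x>0. rodrigues_factor a m f x = poly q x * exp (- x))"
  using assms
proof (induction m arbitrary: p f)
  case 0
  then show ?case
    by (intro exI[of _ p]) (auto simp: rodrigues_factor_def simp flip: powr_add mult.assoc)
next
  case (Suc m)
  define c where "c = real (Suc m) + a"
  define p' where "p' = smult c p + pCons 0 (pderiv p) - pCons 0 p"
  have lt: "degree (smult c p + pCons 0 (pderiv p)) < degree (pCons 0 p)"
  proof -
    have "degree (smult c p) \<le> degree p"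
      by (rule degree_smult_le)
    moreover have "degree (pCons 0 (pderiv p)) \<le> degree p"
    proof (cases "pderiv p = 0")
      case False
      then have "degree p \<noteq> 0" by (simp add: pderiv_eq_0_iff)
      then show ?thesis using False by (simp add: degree_pderiv)
    qed simp
    ultimately have "degree (smult c p + pCons 0 (pderiv p)) \<le> degree p"
      by (rule degree_add_le)
    then show ?thesis using Suc.prems(1) by simp
  qed
  have deg: "degree p' = Suc (degree p)"
    using degree_add_eq_right[of "smult c p + pCons 0 (pderiv p)" "- pCons 0 p"] lt Suc.prems(1)
    by (simp add: p'_def del: minus_pCons)
  then have "p' \<noteq> 0" by auto
  then obtain q where q: "q \<noteq> 0" "degree q = degree p' + m"
      "\<forall>x>0. rodrigues_factor a m (\<lambda>x. poly p' x * exp (- x)) x = poly q x * exp (- x)"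
    using Suc.IH[of p' "\<lambda>x. poly p' x * exp (- x)"] by auto
  have d: "deriv (\<lambda>t. t powr c * f t) x = x powr (real m + a) * (poly p' x * exp (- x))"
    if x: "x > 0" for x
  proof -
    have "deriv (\<lambda>t. t powr c * f t) x = deriv (\<lambda>t. t powr c * (poly p t * exp (- t))) x"
      using deriv_funpow_cong_pos[of "\<lambda>t. t powr c * f t"
          "\<lambda>t. t powr c * (poly p t * exp (- t))" x 1] Suc.prems(2) x by simp
    also have "((\<lambda>t. t powr c * (poly p t * exp (- t))) has_real_derivative
        c * x powr (c - 1) * (poly p x * exp (- x)) +
        (poly (pderiv p) x * exp (- x) - poly p x * exp (- x)) * x powr c) (at x)"
      using x by (auto intro!: derivative_eq_intros simp: algebra_simps)
    then have "deriv (\<lambda>t. t powr c * (poly p t * exp (- t))) x =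
        c * x powr (c - 1) * (poly p x * exp (- x)) +
        (poly (pderiv p) x * exp (- x) - poly p x * exp (- x)) * x powr c"
      by (rule DERIV_imp_deriv)
    also have "x powr c = x powr (c - 1) * x"
      using x by (simp add: powr_diff)
    finally show ?thesis
      by (simp add: p'_def c_def algebra_simps)
  qed
  have "rodrigues_factor a (Suc m) f x = poly q x * exp (- x)" if x: "x > 0" for x
  proof -
    have "(deriv ^^ Suc m) (\<lambda>t. t powr c * f t) x =
          (deriv ^^ m) (\<lambda>t. t powr (real m + a) * (poly p' t * exp (- t))) x"
      unfolding funpow_Suc_right o_def
      by (rule deriv_funpow_cong_pos) (use d x in auto)
    then show ?thesis
      using q(3) x unfolding rodrigues_factor_def c_def by simp
  qed
  then show ?case using q(1,2) deg by (intro exI[of _ q]) auto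
qed

lemma foldr_rodrigues_factor_poly_exp:
  "\<exists>q::real poly. q \<noteq> 0 \<and> degree q = (\<Sum>j\<leftarrow>js. m j) \<and>
     (\<forall>x>0. foldr (\<lambda>j. rodrigues_factor (\<alpha> j) (m j)) js (\<lambda>t. exp (- t)) x
             = poly q x * exp (- x))"
proof (induction js)
  case Nil
  show ?case by (intro exI[of _ 1]) simp
next
  case (Cons j js)
  then obtain q :: "real poly" where q: "q \<noteq> 0" "degree q = (\<Sum>j\<leftarrow>js. m j)"
    "\<And>x. x > 0 \<Longrightarrow> foldr (\<lambda>j. rodrigues_factor (\<alpha> j) (m j)) js (\<lambda>t. exp (- t)) x
             = poly q x * exp (- x)" by blast
  show ?case
    using rodrigues_factor_poly_exp[OF q(1,3), where m = "m j" and a = "\<alpha> j"] q(2)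
    by (auto simp: add.commute)
qed

lemma ex1_mult_laguerre1: "\<exists>!P. is_mult_laguerre1 r \<alpha> m P"
proof (rule ex_ex1I)
  define N where "N = (\<Sum>j=1..r. m j)"
  have N: "(\<Sum>j\<leftarrow>[1..<Suc r]. m j) = N"
    unfolding N_def interv_sum_list_conv_sum_set_nat set_upt
      atLeastLessThanSuc_atLeastAtMost ..
  obtain q :: "real poly" where q: "degree q = N"
    "\<forall>x>0. rodrigues_op r \<alpha> m (\<lambda>t. exp (- t)) x = poly q x * exp (- x)"
    using foldr_rodrigues_factor_poly_exp[where js = "[1..<Suc r]" and m = m and \<alpha> = \<alpha>]
    unfolding N rodrigues_op_def by blast
  have "is_mult_laguerre1 r \<alpha> m (smult ((-1) ^ N) q)"
    unfolding is_mult_laguerre1_def N_def[symmetric] using q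
    by (auto simp flip: power_add mult_2)
  then show "\<exists>P. is_mult_laguerre1 r \<alpha> m P" ..
next
  fix P Q
  assume P: "is_mult_laguerre1 r \<alpha> m P" and Q: "is_mult_laguerre1 r \<alpha> m Q"
  have "poly (P - Q) x = 0" if "x > 0" for x
  proof -
    have "(-1) ^ (\<Sum>j=1..r. m j) * exp (- x) * poly P x
        = (-1) ^ (\<Sum>j=1..r. m j) * exp (- x) * poly Q x"
      using P Q that unfolding is_mult_laguerre1_def by presburger
    then show ?thesis by simp
  qed
  then have "{0<..} \<subseteq> {x. poly (P - Q) x = 0}" by auto
  then have "\<not> finite {x. poly (P - Q) x = 0}"
    using infinite_Ioi[of "0::real"] finite_subset by blast
  then show "P = Q" using poly_roots_finite[of "P - Q"] by auto
qed

end

theory Submission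
  imports Defs "HOL-Complex_Analysis.Complex_Analysis"
begin

text \<open>On a power series the operator \<open>x\<^sup>-\<^sup>\<alpha> D\<^sup>n x\<^sup>n\<^sup>+\<^sup>\<alpha>\<close> acts diagonally: it multiplies the coefficient of
  \<open>x\<^sup>k\<close> by \<open>(\<alpha> + 1 + k)\<^sub>n\<close>. Expanding \<open>e\<^sup>-\<^sup>x\<close> and using
  \<open>(\<alpha> + 1 + k)\<^sub>n / (\<alpha> + 1)\<^sub>n = (\<alpha> + 1 + n)\<^sub>k / (\<alpha> + 1)\<^sub>k\<close>, the Rodrigues formula expresses the normalised
  polynomial as \<open>e\<^sup>x\<close> times a hypergeometric series whose coefficients, after rescaling, converge
  and are dominated by \<open>C\<^sup>k / k!\<close>. Tannery's theorem then gives the limit.\<close>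

section \<open>Diagonal action of the Rodrigues operators on power series\<close>

lemma rodrigues_factor_sums:
  fixes b :: "nat \<Rightarrow> real"
  assumes "\<And>x. x > 0 \<Longrightarrow> (\<lambda>k. b k * x ^ k) sums f x" and "x > 0"
  shows "(\<lambda>k. pochhammer (a + 1 + real k) n * b k * x ^ k) sums rodrigues_factor a n f x"
  using assms
proof (induction n arbitrary: b f x)
  case 0
  then show ?case
    by (simp add: rodrigues_factor_def flip: powr_add mult.assoc)
next
  case (Suc n)
  define c where "c = real (Suc n) + a"
  \<comment> \<open>The hypothesis only covers positive arguments, but
    \<open>\<bar>y\<bar> + 1\<close> is such an argument and lies strictly beyond \<open>y\<close>,
    so the series converges on the whole line.\<close>
  have summ: "summable (\<lambda>k. b k * y ^ k)" for y
    by (rule powser_inside[of _ "\<bar>y\<bar> + 1"])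
      (use sums_summable[OF Suc.prems(1)[of "\<bar>y\<bar> + 1"]] in auto)
  define F where "F = (\<lambda>y. \<Sum>k. b k * y ^ k)"
  define F' where "F' = (\<lambda>y. \<Sum>k. diffs b k * y ^ k)"
  have f: "f y = F y" if "y > 0" for y
    using Suc.prems(1)[OF that] by (simp add: F_def sums_iff)
  have F: "(F has_real_derivative F' y) (at y)" for y
    unfolding F_def F'_def by (rule termdiffs_strong_converges_everywhere[OF summ])
  have F'_sums: "(\<lambda>k. real k * b k * y ^ k) sums (y * F' y)" for y
  proof -
    have "(\<lambda>k. real k * b k * y ^ (k - Suc 0)) sums F' y"
      unfolding F'_def by (rule diffs_equiv[OF termdiff_converges_all[OF summ]])
    then have "(\<lambda>k. y * (real k * b k * y ^ (k - Suc 0))) sums (y * F' y)"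
      by (rule sums_mult)
    moreover have "y * (real k * b k * y ^ (k - Suc 0)) = real k * b k * y ^ k" for k
      by (cases k) auto
    ultimately show ?thesis by simp
  qed
  \<comment> \<open>One differentiation turns \<open>t powr c * f t\<close> into
    \<open>t powr (c - 1) * g t\<close>, and \<open>c - 1 = n + a\<close> is exactly the weight in
    the factor of order \<open>n\<close>. So the induction hypothesis applies to \<open>g\<close>.
    Its coefficients carry the multiplier \<open>c + k = a + 1 + k + n\<close>, the last factor of
    the Pochhammer symbol of length \<open>Suc n\<close>.\<close>
  define g where "g = (\<lambda>y. c * F y + y * F' y)"
  have g_sums: "(\<lambda>k. ((c + real k) * b k) * y ^ k) sums g y" for y
  proof -
    have "(\<lambda>k. c * (b k * y ^ k) + real k * b k * y ^ k) sums g y"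
      unfolding g_def F_def by (intro sums_add sums_mult summable_sums summ F'_sums)
    then show ?thesis by (simp add: algebra_simps)
  qed
  have d: "deriv (\<lambda>t. t powr c * f t) y = y powr (real n + a) * g y" if y: "y > 0" for y
  proof -
    have "deriv (\<lambda>t. t powr c * f t) y = deriv (\<lambda>t. t powr c * F t) y"
      using deriv_funpow_cong_pos[of "\<lambda>t. t powr c * f t" "\<lambda>t. t powr c * F t" y 1] f y
      by simp
    also have "((\<lambda>t. t powr c * F t) has_real_derivative
        c * y powr (c - 1) * F y + F' y * y powr c) (at y)"
      using y by (auto intro!: derivative_eq_intros F)
    then have "deriv (\<lambda>t. t powr c * F t) y = c * y powr (c - 1) * F y + F' y * y powr c"
      by (rule DERIV_imp_deriv)
    also have "y powr c = y powr (c - 1) * y"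
      using y by (simp add: powr_diff)
    finally show ?thesis
      by (simp add: g_def c_def algebra_simps)
  qed
  have "(deriv ^^ Suc n) (\<lambda>t. t powr c * f t) x =
        (deriv ^^ n) (\<lambda>t. t powr (real n + a) * g t) x"
    unfolding funpow_Suc_right o_def
    by (rule deriv_funpow_cong_pos) (use d Suc.prems(2) in auto)
  then have "rodrigues_factor a (Suc n) f x = rodrigues_factor a n g x"
    unfolding rodrigues_factor_def c_def by simp
  moreover have "(\<lambda>k. pochhammer (a + 1 + real k) n * ((c + real k) * b k) * x ^ k)
      sums rodrigues_factor a n g x"
    by (rule Suc.IH) (use g_sums Suc.prems(2) in auto)
  moreover have "pochhammer (a + 1 + real k) n * ((c + real k) * b k) =
      pochhammer (a + 1 + real k) (Suc n) * b k" for k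
    by (simp add: pochhammer_Suc c_def algebra_simps)
  ultimately show ?case by simp
qed

lemma foldr_rodrigues_factor_sums:
  fixes b :: "nat \<Rightarrow> real"
  assumes "\<And>x. x > 0 \<Longrightarrow> (\<lambda>k. b k * x ^ k) sums f x" and "x > 0"
  shows "(\<lambda>k. (\<Prod>j\<leftarrow>js. pochhammer (\<alpha> j + 1 + real k) (m j)) * b k * x ^ k) sums
           foldr (\<lambda>j. rodrigues_factor (\<alpha> j) (m j)) js f x"
  using assms(2)
proof (induction js arbitrary: x)
  case Nil
  then show ?case using assms(1) by simp
next
  case (Cons j js)
  show ?case
    using rodrigues_factor_sums[OF Cons.IH Cons.prems, where a = "\<alpha> j" and n = "m j"]
    by (simp add: mult.assoc)
qed

lemma mult_laguerre1_sums:
  assumes "x > 0"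
  shows "(\<lambda>k. (\<Prod>j=1..r. pochhammer (\<alpha> j + 1 + real k) (m j)) * ((-1) ^ k / fact k) * x ^ k) sums
           ((-1) ^ (\<Sum>j=1..r. m j) * exp (- x) * poly (mult_laguerre1 r \<alpha> m) x)"
proof -
  have "is_mult_laguerre1 r \<alpha> m (mult_laguerre1 r \<alpha> m)"
    unfolding mult_laguerre1_def by (rule theI'[OF ex1_mult_laguerre1])
  then have "(-1) ^ (\<Sum>j=1..r. m j) * exp (- x) * poly (mult_laguerre1 r \<alpha> m) x =
      rodrigues_op r \<alpha> m (\<lambda>t. exp (- t)) x"
    using assms unfolding is_mult_laguerre1_def by blast
  moreover have "(\<lambda>k. (-1) ^ k / fact k * t ^ k) sums exp (- t)" for t :: real
    using exp_converges[of "- t"] by (simp add: power_minus[of t] divide_inverse mult_ac)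
  then have "(\<lambda>k. (\<Prod>j\<leftarrow>[1..<Suc r]. pochhammer (\<alpha> j + 1 + real k) (m j)) *
      ((-1) ^ k / fact k) * x ^ k) sums rodrigues_op r \<alpha> m (\<lambda>t. exp (- t)) x"
    unfolding rodrigues_op_def by (rule foldr_rodrigues_factor_sums) (use assms in auto)
  moreover have "(\<Prod>j\<leftarrow>[1..<Suc r]. h j) = (\<Prod>j=1..r. h j)" for h :: "nat \<Rightarrow> real"
    using prod.distinct_set_conv_list[of "[1..<Suc r]" h]
    by (simp add: atLeastLessThanSuc_atLeastAtMost del: upt_Suc)
  ultimately show ?thesis by (simp del: upt_Suc)
qed

lemma poly_map_poly_of_real:
  "poly (map_poly of_real p) (of_real x :: complex) = of_real (poly p x)"
  by (induction p) (auto simp: map_poly_pCons)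

text \<open>The Rodrigues formula speaks only of positive reals. Both sides here are entire and
  agree on the positive half-line, which accumulates at 0, so the identity theorem carries the
  formula over to complex \<open>z\<close>.\<close>

lemma mult_laguerre1_complex:
  fixes r :: nat and \<alpha> :: "nat \<Rightarrow> real" and m :: "nat \<Rightarrow> nat" and z :: complex
  defines "b \<equiv> \<lambda>k. (\<Prod>j=1..r. pochhammer (\<alpha> j + 1 + real k) (m j)) * ((-1) ^ k / fact k)"
  shows "(-1) ^ (\<Sum>j=1..r. m j) * poly (map_poly of_real (mult_laguerre1 r \<alpha> m)) z =
           exp z * (\<Sum>k. of_real (b k) * z ^ k)"
proof -
  define P where "P = (\<lambda>z::complex. (-1) ^ (\<Sum>j=1..r. m j) *
    poly (map_poly of_real (mult_laguerre1 r \<alpha> m)) z)"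
  define G where "G = (\<lambda>z::complex. \<Sum>k. of_real (b k) * z ^ k)"
  have b: "(\<lambda>k. b k * x ^ k) sums
      ((-1) ^ (\<Sum>j=1..r. m j) * exp (- x) * poly (mult_laguerre1 r \<alpha> m) x)" if "x > 0" for x
    using mult_laguerre1_sums[OF that] unfolding b_def .
  have G_real: "(\<lambda>k. of_real (b k) * of_real x ^ k) sums
      (exp (- of_real x) * P (of_real x))" if "x > 0" for x
    using sums_of_real[OF b[OF that], where 'a = complex]
    by (simp add: P_def poly_map_poly_of_real mult_ac flip: exp_of_real)
  have summ: "summable (\<lambda>k. of_real (b k) * w ^ k)" for w :: complex
  proof (rule powser_inside)
    show "summable (\<lambda>k. of_real (b k) * complex_of_real (norm w + 1) ^ k)"
      using G_real[of "norm w + 1"] by (intro sums_summable) (auto simp: add_nonneg_pos)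
    show "norm w < norm (complex_of_real (norm w + 1))"
      unfolding norm_of_real by simp
  qed
  have hol_G: "G holomorphic_on UNIV"
  proof -
    have "(G has_field_derivative (\<Sum>k. diffs (\<lambda>k. of_real (b k)) k * w ^ k)) (at w)" for w
      unfolding G_def by (rule termdiffs_strong_converges_everywhere[OF summ])
    then show ?thesis by (subst holomorphic_on_open) auto
  qed
  have "P z - exp z * G z = 0"
  proof (rule analytic_continuation[where f = "\<lambda>z. P z - exp z * G z"])
    show "(\<lambda>z. P z - exp z * G z) holomorphic_on UNIV"
      unfolding P_def by (intro holomorphic_intros hol_G)
    show "(0::complex) islimpt of_real ` {0<..}"
      unfolding islimpt_approachable
    proof (intro allI impI)
      fix e :: real
      assume "e > 0"
      then show "\<exists>x'\<in>of_real ` {0<..}. x' \<noteq> (0::complex) \<and> dist x' 0 < e"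
        by (intro bexI[of _ "of_real (e / 2)"]) (auto simp del: of_real_divide)
    qed
    fix w :: complex
    assume "w \<in> of_real ` {0<..}"
    then obtain x :: real where x: "x > 0" "w = of_real x" by auto
    then have "G w = exp (- w) * P w"
      using G_real[OF x(1)] by (simp add: G_def sums_iff)
    then show "P w - exp w * G w = 0"
      by (simp add: exp_minus)
  qed auto
  then show ?thesis by (simp add: P_def G_def)
qed

text \<open>Both quotients equal (a)_{m+k} / ((a)_m (a)_k), since (a)_{m+k} can be split after
  \<open>m\<close> or after \<open>k\<close> factors. This trades products whose length
  \<open>m\<close> grows for products of fixed length \<open>k\<close>.\<close>

lemma pochhammer_ratio_swap:
  fixes a :: "'a::field_char_0"
  assumes "pochhammer a m \<noteq> 0" "pochhammer a k \<noteq> 0"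
  shows "pochhammer (a + of_nat k) m / pochhammer a m = pochhammer (a + of_nat m) k / pochhammer a k"
  using assms pochhammer_product'[of a k m] pochhammer_product'[of a m k]
  by (simp add: field_simps add.commute)

text \<open>On the disc of radius \<open>R\<close> the difference of the two series is at most the
  sum of \<open>norm (c n k - d k) * R ^ k\<close>, which no longer depends on \<open>z\<close>.
  Tannery's theorem with majorant \<open>2 * (M k * R ^ k)\<close> sends this sum to 0.\<close>

lemma uniform_limit_powser:
  fixes c :: "nat \<Rightarrow> nat \<Rightarrow> 'a::{real_normed_field,banach}"
  assumes lim: "\<And>k. (\<lambda>n. c n k) \<longlonglongrightarrow> d k"
    and bound: "eventually (\<lambda>n. \<forall>k. norm (c n k) \<le> M k) sequentially"
    and summ: "summable (\<lambda>k. M k * R ^ k)" and K: "K \<subseteq> cball 0 R"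
  shows "uniform_limit K (\<lambda>n z. \<Sum>k. c n k * z ^ k) (\<lambda>z. \<Sum>k. d k * z ^ k) sequentially"
proof (cases "R < 0")
  case True
  then have "K = {}" using K by auto
  then show ?thesis by (simp add: uniform_limit_iff)
next
  case False
  then have R: "R \<ge> 0" by simp
  \<comment> \<open>The bound passes to the limit coefficients, which is where the factor 2 in the
    majorant comes from.\<close>
  have d: "norm (d k) \<le> M k" for k
    by (rule tendsto_upperbound[OF tendsto_norm[OF lim]])
      (use bound in \<open>auto elim: eventually_mono\<close>)
  have "eventually (\<lambda>(k, n). norm (norm (c n k - d k) * R ^ k) \<le> 2 * (M k * R ^ k))
      (at_top \<times>\<^sub>F sequentially)"
  proof (rule eventually_mono)
    show "eventually (\<lambda>(_ :: nat, n). \<forall>k. norm (c n k) \<le> M k) (at_top \<times>\<^sub>F sequentially)"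
      by (subst eventually_prod2[OF sequentially_bot]) (rule bound)
  next
    fix x :: "nat \<times> nat"
    obtain k n where x: "x = (k, n)" by fastforce
    assume "case x of (_, n) \<Rightarrow> \<forall>k. norm (c n k) \<le> M k"
    then have "norm (c n k) \<le> M k" by (simp add: x)
    then have "norm (c n k - d k) \<le> 2 * M k"
      using d[of k] norm_triangle_ineq4[of "c n k" "d k"] by linarith
    then show "case x of (k, n) \<Rightarrow> norm (norm (c n k - d k) * R ^ k) \<le> 2 * (M k * R ^ k)"
      using R by (simp add: x abs_mult mult_right_mono flip: mult.assoc)
  qed
  moreover have "(\<lambda>n. norm (c n k - d k) * R ^ k) \<longlonglongrightarrow> 0" for k
    using lim[of k] by (intro tendsto_mult_left_zero tendsto_norm_zero) (simp add: LIM_zero)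
  moreover have "summable (\<lambda>k. 2 * (M k * R ^ k))"
    by (intro summable_mult summ)
  ultimately have ev: "eventually (\<lambda>n. summable (\<lambda>k. norm (norm (c n k - d k) * R ^ k))) sequentially"
    and zero: "(\<lambda>n. \<Sum>k. norm (c n k - d k) * R ^ k) \<longlonglongrightarrow> (\<Sum>k. 0)"
    using tannerys_theorem[of "\<lambda>k n. norm (c n k - d k) * R ^ k" "\<lambda>_. 0" sequentially
        "\<lambda>k. 2 * (M k * R ^ k)"] by auto
  show ?thesis
  proof (rule uniform_limitI)
    fix e :: real
    assume "e > 0"
    then have "eventually (\<lambda>n. (\<Sum>k. norm (c n k - d k) * R ^ k) < e) sequentially"
      using order_tendstoD(2)[OF zero, of e] by simp
    with ev bound
    show "eventually (\<lambda>n. \<forall>z\<in>K. dist (\<Sum>k. c n k * z ^ k) (\<Sum>k. d k * z ^ k) < e) sequentially"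
    proof eventually_elim
      case (elim n)
      show ?case
      proof
        fix z
        assume "z \<in> K"
        then have z: "norm z \<le> R" using K by auto
        have le: "norm (u * z ^ k) \<le> s * R ^ k" if "norm u \<le> s" for u s k
          unfolding norm_mult norm_power using that z
          by (intro mult_mono power_mono) (auto intro: order_trans[OF norm_ge_zero])
        have s: "summable (\<lambda>k. c n k * z ^ k)" "summable (\<lambda>k. d k * z ^ k)"
          by (rule summable_comparison_test'[OF summ], rule le, use elim d in auto)+
        have sd: "summable (\<lambda>k. norm (c n k - d k) * R ^ k)"
          using elim(1) R by (simp add: abs_mult)
        have "dist (\<Sum>k. c n k * z ^ k) (\<Sum>k. d k * z ^ k) = norm (\<Sum>k. (c n k - d k) * z ^ k)"
          by (simp add: dist_norm suminf_diff[OF s] left_diff_distrib)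
        also have "\<dots> \<le> (\<Sum>k. norm (c n k - d k) * R ^ k)"
          by (rule norm_suminf_le[OF _ sd], rule le) simp
        also have "\<dots> < e" by (rule elim)
        finally show "dist (\<Sum>k. c n k * z ^ k) (\<Sum>k. d k * z ^ k) < e" .
      qed
    qed
  qed
qed

text \<open>The number \<open>k\<close> of factors is fixed, and after division by \<open>n\<close>
  each factor is \<open>m n / n\<close> plus a term of order 1/n.\<close>

lemma tendsto_pochhammer_over_power:
  fixes a q :: real and m :: "nat \<Rightarrow> nat"
  assumes "(\<lambda>n. real (m n) / real n) \<longlonglongrightarrow> q"
  shows "(\<lambda>n. pochhammer (a + real (m n)) k / real n ^ k) \<longlonglongrightarrow> q ^ k"
proof -
  have "(\<lambda>n. \<Prod>i<k. (a + real i) / real n + real (m n) / real n) \<longlonglongrightarrow> (\<Prod>i<k. 0 + q)"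
    by (intro tendsto_intros assms lim_const_over_n)
  moreover have "(\<Prod>i<k. (a + real i) / real n + real (m n) / real n) =
      pochhammer (a + real (m n)) k / real n ^ k" for n
    by (simp add: pochhammer_prod lessThan_atLeast0 prod_dividef algebra_simps flip: add_divide_distrib)
  ultimately show ?thesis by simp
qed

text \<open>Factor by factor, with s = a + i, one has (s + m) / (n s) = 1/n + (m/n)/s, and n \<ge>
  1, m/n \<le> q, s \<ge> a. The bound is free of \<open>n\<close> and geometric in
  \<open>k\<close>, as domination requires.\<close>

lemma pochhammer_over_power_bound:
  fixes a q :: real
  assumes "a > 0" "n > 0" "real m \<le> q * real n"
  shows "pochhammer (a + real m) k / real n ^ k / pochhammer a k \<le> (1 + q / a) ^ k"
proof -
  have q: "q \<ge> 0"
    using assms by (meson of_nat_0_le_iff order_trans zero_le_mult_iff of_nat_0_less_iff not_le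
        mult_neg_pos)
  have "pochhammer (a + real m) k / real n ^ k / pochhammer a k =
      (\<Prod>i\<in>{0..<k}. (a + real m + real i) / real n / (a + real i))"
    by (simp add: pochhammer_prod prod_dividef prod.distrib)
  also have "\<dots> \<le> (\<Prod>i\<in>{0..<k}. 1 + q / a)"
  proof (intro prod_mono conjI)
    fix i
    show "0 \<le> (a + real m + real i) / real n / (a + real i)" using assms by simp
    have "(a + real m + real i) / real n / (a + real i) =
        1 / real n + (real m / real n) / (a + real i)"
    proof -
      have "(s + real m) / real n / s = 1 / real n + (real m / real n) / s" if "s > 0" for s
        using that assms(2) by (simp add: field_simps)
      from this[of "a + real i"] show ?thesis
        using assms(1) by (simp add: add_pos_nonneg algebra_simps)
    qed
    also have "\<dots> \<le> 1 + q / a"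
      using assms q by (intro add_mono frac_le) (auto simp: field_simps)
    finally show "(a + real m + real i) / real n / (a + real i) \<le> 1 + q / a" .
  qed
  finally show ?thesis by simp
qed

theorem theorem3:
  fixes r :: nat and \<alpha> q :: "nat \<Rightarrow> real" and m :: "nat \<Rightarrow> nat \<Rightarrow> nat" and K :: "complex set"
  assumes "r \<ge> 1"
    and "\<And>j. j \<in> {1..r} \<Longrightarrow> \<alpha> j > -1"
    and "\<And>i j. i \<in> {1..r} \<Longrightarrow> j \<in> {1..r} \<Longrightarrow> i \<noteq> j \<Longrightarrow> \<alpha> i - \<alpha> j \<notin> \<int>"
    and "\<And>j. j \<in> {1..r} \<Longrightarrow> q j > 0"
    and "(\<Sum>j=1..r. q j) = 1"
    and "\<And>n j. j \<in> {1..r} \<Longrightarrow> m n j = nat \<lfloor>q j * real n\<rfloor>"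
    and "compact K"
  shows "uniform_limit K
     (\<lambda>n z. (-1) ^ (\<Sum>j=1..r. m n j)
        * poly (map_poly complex_of_real (mult_laguerre1 r \<alpha> (m n))) (z / of_nat n ^ r)
        / of_real (\<Prod>j=1..r. pochhammer (\<alpha> j + 1) (m n j)))
     (\<lambda>z. hypergeom_0F r (\<lambda>j. of_real (\<alpha> j + 1)) (- of_real (\<Prod>j=1..r. q j) * z))
     sequentially"
proof -
  let ?a = "\<lambda>j. \<alpha> j + 1"
  have a: "?a j > 0" if "j \<in> {1..r}" for j
    using assms(2)[OF that] by simp
  \<comment> \<open>The coefficients of the normalised series at \<open>z / n ^ r\<close>, after the
    Pochhammer swap: the power \<open>n ^ (r * k)\<close> is shared out as one \<open>n ^ k\<close>
    for each of the \<open>r\<close> indices. \<open>d\<close> is their limit, and \<open>C\<close>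
    collects the \<open>r\<close> geometric ratios.\<close>
  define c where "c = (\<lambda>n k. (\<Prod>j=1..r. pochhammer (?a j + real (m n j)) k / real n ^ k /
      pochhammer (?a j) k) * ((-1) ^ k / fact k))"
  define d where "d = (\<lambda>k. (\<Prod>j=1..r. q j ^ k / pochhammer (?a j) k) * ((-1) ^ k / fact k))"
  define C where "C = (\<Prod>j=1..r. 1 + q j / ?a j)"
  obtain R where R: "K \<subseteq> cball 0 R"
    using bounded_subset_ballD[OF compact_imp_bounded[OF assms(7)], of 0] ball_subset_cball by blast

  \<comment> \<open>Growth of the multi-index\<close>
  have m_lim: "(\<lambda>n. real (m n j) / real n) \<longlonglongrightarrow> q j" and m_le: "real (m n j) \<le> q j * real n"
    if j: "j \<in> {1..r}" for j n
  proof -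
    have fl: "real (m n j) = of_int \<lfloor>q j * real n\<rfloor>" for n
      using assms(4,6)[OF j] by simp
    show "real (m n j) \<le> q j * real n" unfolding fl by linarith
    have "(\<lambda>n. q j - 1 / real n) \<longlonglongrightarrow> q j - 0"
      by (intro tendsto_intros lim_const_over_n)
    then have lower: "(\<lambda>n. q j - 1 / real n) \<longlonglongrightarrow> q j" by simp
    show "(\<lambda>n. real (m n j) / real n) \<longlonglongrightarrow> q j"
    proof (rule tendsto_sandwich[OF _ _ lower tendsto_const])
      show "eventually (\<lambda>n. q j - 1 / real n \<le> real (m n j) / real n) sequentially"
        using eventually_gt_at_top[of 0]
      proof eventually_elim
        case (elim n)
        have "q j * real n - 1 \<le> real (m n j)" unfolding fl by linarith
        then have "(q j * real n - 1) / real n \<le> real (m n j) / real n"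
          by (rule divide_right_mono) simp
        then show ?case using elim by (simp add: diff_divide_distrib)
      qed
      show "eventually (\<lambda>n. real (m n j) / real n \<le> q j) sequentially"
        using eventually_gt_at_top[of 0]
      proof eventually_elim
        case (elim n)
        have "real (m n j) \<le> q j * real n" unfolding fl by linarith
        then show ?case using elim by (simp add: field_simps)
      qed
    qed
  qed

  \<comment> \<open>Limit and domination of the coefficients\<close>
  have c_lim: "(\<lambda>n. c n k) \<longlonglongrightarrow> d k" for k
    unfolding c_def d_def
    using a by (intro tendsto_mult tendsto_prod tendsto_divide tendsto_const
        tendsto_pochhammer_over_power m_lim) (auto simp: pochhammer_pos less_imp_neq[symmetric])
  have c_le: "\<bar>c n k\<bar> \<le> C ^ k / fact k" if n: "n > 0" for n k
  proof -
    let ?p = "\<lambda>j. pochhammer (?a j + real (m n j)) k / real n ^ k / pochhammer (?a j) k"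
    have nonneg: "0 \<le> ?p j" if "j \<in> {1..r}" for j
      using a[OF that] by (intro divide_nonneg_nonneg pochhammer_nonneg) auto
    have "\<bar>c n k\<bar> = (\<Prod>j=1..r. ?p j) / fact k"
      unfolding c_def abs_mult using prod_nonneg[of "{1..r}" ?p] nonneg
      by (simp add: power_abs)
    also have "(\<Prod>j=1..r. ?p j) \<le> (\<Prod>j=1..r. (1 + q j / ?a j) ^ k)"
      using nonneg a m_le n by (intro prod_mono conjI pochhammer_over_power_bound)
    finally show ?thesis
      by (simp add: C_def prod_power_distrib divide_right_mono)
  qed
  have d_le: "\<bar>d k\<bar> \<le> C ^ k / fact k" for k
    by (rule tendsto_upperbound[OF tendsto_rabs[OF c_lim]])
      (auto intro!: c_le eventually_mono[OF eventually_gt_at_top[of 0]])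
  have summ: "summable (\<lambda>k. complex_of_real (s k) * z ^ k)"
    if "\<And>k. \<bar>s k\<bar> \<le> C ^ k / fact k" for s z
  proof (rule summable_comparison_test')
    show "summable (\<lambda>k. C ^ k / fact k * norm z ^ k)"
      using summable_exp[of "C * norm z"] by (simp add: power_mult_distrib field_simps)
    show "norm (complex_of_real (s k) * z ^ k) \<le> C ^ k / fact k * norm z ^ k" for k
      unfolding norm_mult norm_power norm_of_real by (intro mult_right_mono that) simp
  qed

  \<comment> \<open>Uniform convergence of the hypergeometric series\<close>
  have series: "uniform_limit K (\<lambda>n z. \<Sum>k. complex_of_real (c n k) * z ^ k)
      (\<lambda>z. \<Sum>k. complex_of_real (d k) * z ^ k) sequentially"
  proof (rule uniform_limit_powser[where M = "\<lambda>k. C ^ k / fact k", OF _ _ _ R])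
    show "(\<lambda>n. complex_of_real (c n k)) \<longlonglongrightarrow> complex_of_real (d k)" for k
      by (intro tendsto_of_real c_lim)
    show "eventually (\<lambda>n. \<forall>k. norm (complex_of_real (c n k)) \<le> C ^ k / fact k) sequentially"
      by (rule eventually_mono[OF eventually_gt_at_top[of 0]]) (simp add: c_le)
    show "summable (\<lambda>k. C ^ k / fact k * R ^ k)"
      using summable_exp[of "C * R"] by (simp add: power_mult_distrib field_simps)
  qed

  \<comment> \<open>The exponential prefactor\<close>
  have exp_lim: "uniform_limit K (\<lambda>n z. exp (z / of_nat n ^ r)) (\<lambda>z. exp 0) sequentially"
  proof (rule uniform_limit_compose_uniformly_continuous_on[where
        f = exp and B = "cball 0 R"])
    show "uniformly_continuous_on (cball 0 R) (exp :: complex \<Rightarrow> complex)"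
      by (intro compact_uniformly_continuous continuous_intros) auto
    \<comment> \<open>The radius may be negative when \<open>K\<close> is empty, so its sign is read
      off from a point of \<open>K\<close>.\<close>
    have R0: "R \<ge> 0" if "z \<in> K" for z
    proof -
      have "norm z \<le> R" using that R by auto
      then show ?thesis using norm_ge_zero[of z] by linarith
    qed
    \<comment> \<open>Since \<open>r\<close> is at least 1, \<open>n ^ r\<close> dominates
      \<open>n\<close>, and one rate serves all \<open>r\<close>.\<close>
    have le: "norm (z / of_nat n ^ r) \<le> R / real n" if "z \<in> K" "n > 0" for n z
    proof -
      have "norm (z / of_nat n ^ r) \<le> R / real n ^ r"
        using that R by (auto simp: norm_divide norm_power intro!: divide_right_mono)
      also have "\<dots> \<le> R / real n"
        using that R0 assms(1) by (intro divide_left_mono self_le_power) auto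
      finally show ?thesis .
    qed
    show "uniform_limit K (\<lambda>n z. z / of_nat n ^ r) (\<lambda>z. 0) sequentially"
    proof (rule uniform_limitI)
      fix e :: real
      assume "e > 0"
      then have "eventually (\<lambda>n. R / real n < e) sequentially"
        using order_tendstoD(2)[OF lim_const_over_n[of R]] by simp
      with eventually_gt_at_top[of 0]
      show "eventually (\<lambda>n. \<forall>z\<in>K. dist (z / of_nat n ^ r) 0 < e) sequentially"
      proof eventually_elim
        case (elim n)
        then show ?case
          unfolding dist_norm diff_0_right using le by (blast intro: le_less_trans)
      qed
    qed
    \<comment> \<open>The rescaled points must stay in the compact disc on which \<open>exp\<close>
      is uniformly continuous; \<open>R / n\<close> is at most \<open>R\<close> once
      \<open>n\<close> is positive.\<close>
    show "eventually (\<lambda>n. \<forall>z\<in>K. z / of_nat n ^ r \<in> cball 0 R) sequentially"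
      using eventually_gt_at_top[of 0]
    proof eventually_elim
      case (elim n)
      have "norm (z / of_nat n ^ r) \<le> R" if "z \<in> K" for z
      proof -
        have "R / real n \<le> R / 1"
          using elim R0[OF that] by (intro divide_left_mono) auto
        then show ?thesis using le[OF that elim] by simp
      qed
      then show ?case by (simp only: mem_cball dist_0_norm) blast
    qed
  qed auto

  have "bounded ((\<lambda>z. \<Sum>k. complex_of_real (d k) * z ^ k) ` K)"
  proof (intro compact_imp_bounded compact_continuous_image assms(7))
    show "continuous_on K (\<lambda>z. \<Sum>k. complex_of_real (d k) * z ^ k)"
      by (intro continuous_at_imp_continuous_on ballI
          isCont_powser_converges_everywhere summ d_le)
  qed
  \<comment> \<open>A product of uniform limits needs bounded limit functions: one is the constant
    \<open>exp 0\<close>, the other is continuous on the compact set \<open>K\<close>.\<close>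
  then have "uniform_limit K (\<lambda>n z. exp (z / of_nat n ^ r) * (\<Sum>k. complex_of_real (c n k) * z ^ k))
      (\<lambda>z. exp 0 * (\<Sum>k. complex_of_real (d k) * z ^ k)) sequentially"
    by (intro uniform_lim_mult exp_lim series) (auto simp: image_constant_conv)
  moreover have "exp 0 * (\<Sum>k. complex_of_real (d k) * z ^ k) =
      hypergeom_0F r (\<lambda>j. of_real (?a j)) (- of_real (\<Prod>j=1..r. q j) * z)" for z
  proof -
    have "complex_of_real (d k) * z ^ k = (- of_real (\<Prod>j=1..r. q j) * z) ^ k /
        ((\<Prod>j=1..r. pochhammer (of_real (?a j)) k) * fact k)" for k
    proof -
      have "(- of_real (\<Prod>j=1..r. q j) * z) ^ k = (-1) ^ k * (\<Prod>j=1..r. of_real (q j) ^ k) * z ^ k"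
        unfolding power_mult_distrib
        by (subst power_minus) (simp add: prod_power_distrib)
      then show ?thesis
        unfolding d_def pochhammer_of_real by (simp add: prod_dividef del: of_real_add)
    qed
    then show ?thesis by (simp add: hypergeom_0F_def)
  qed

  \<comment> \<open>Exact identity with the normalised polynomial for positive
    \<open>n\<close>\<close>
  moreover have "eventually (\<lambda>n. \<forall>z\<in>K.
      exp (z / of_nat n ^ r) * (\<Sum>k. complex_of_real (c n k) * z ^ k) =
      (-1) ^ (\<Sum>j=1..r. m n j)
        * poly (map_poly complex_of_real (mult_laguerre1 r \<alpha> (m n))) (z / of_nat n ^ r)
        / of_real (\<Prod>j=1..r. pochhammer (?a j) (m n j))) sequentially"
    using eventually_gt_at_top[of 0]
  proof eventually_elim
    case (elim n)
    show ?case
    proof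
      fix z
      define D where "D = (\<Prod>j=1..r. pochhammer (?a j) (m n j))"
      have poch: "pochhammer (?a j) k \<noteq> 0" if "j \<in> {1..r}" for j k
        using pochhammer_pos[OF a[OF that], of k] by simp
      have D: "D \<noteq> 0"
        unfolding D_def using poch by simp
      define b where "b = (\<lambda>k. (\<Prod>j=1..r. pochhammer (?a j + real k) (m n j)) *
        ((-1) ^ k / fact k))"
      \<comment> \<open>Dividing by \<open>D\<close> normalises each Pochhammer factor, and
        \<open>pochhammer_ratio_swap\<close> then moves the index \<open>m n j\<close> from the
        length into the base, giving the factors of \<open>c n k\<close>.\<close>
      have scaled: "b k / (real n ^ r) ^ k = D * c n k" for k
      proof -
        have "(\<Prod>j=1..r. pochhammer (?a j + real k) (m n j)) / (real n ^ r) ^ k / D =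
            (\<Prod>j=1..r. pochhammer (?a j + real k) (m n j) / pochhammer (?a j) (m n j) / real n ^ k)"
          by (simp add: D_def prod_dividef prod.distrib mult.commute flip: power_mult)
        also have "\<dots> = (\<Prod>j=1..r. pochhammer (?a j + real (m n j)) k / real n ^ k / pochhammer (?a j) k)"
          using poch by (intro prod.cong refl) (simp add: pochhammer_ratio_swap)
        finally have c: "(\<Prod>j=1..r. pochhammer (?a j + real k) (m n j)) / (real n ^ r) ^ k / D *
            ((-1) ^ k / fact k) = c n k"
          unfolding c_def by (rule arg_cong)
        show ?thesis
          unfolding b_def c[symmetric] using D by (simp add: mult_ac)
      qed
      have "complex_of_real (b k) * (z / of_nat n ^ r) ^ k =
          of_real D * (complex_of_real (c n k) * z ^ k)" for k
      proof -
        have "complex_of_real (b k) * (z / of_nat n ^ r) ^ k =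
            of_real (b k / (real n ^ r) ^ k) * z ^ k"
          by (simp add: power_divide)
        also have "\<dots> = of_real (D * c n k) * z ^ k"
          unfolding scaled ..
        finally show ?thesis by simp
      qed
      \<comment> \<open>Pulling \<open>D\<close> out of the series needs convergence, which rests on
        \<open>c_le\<close> and hence on \<open>n\<close> being positive.\<close>
      then have "(\<Sum>k. complex_of_real (b k) * (z / of_nat n ^ r) ^ k) =
          of_real D * (\<Sum>k. complex_of_real (c n k) * z ^ k)"
        using suminf_mult[OF summ[OF c_le[OF elim]]] by simp
      moreover have "(-1) ^ (\<Sum>j=1..r. m n j)
          * poly (map_poly complex_of_real (mult_laguerre1 r \<alpha> (m n))) (z / of_nat n ^ r) =
          exp (z / of_nat n ^ r) * (\<Sum>k. complex_of_real (b k) * (z / of_nat n ^ r) ^ k)"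
        unfolding b_def by (rule mult_laguerre1_complex)
      ultimately show "exp (z / of_nat n ^ r) * (\<Sum>k. complex_of_real (c n k) * z ^ k) =
          (-1) ^ (\<Sum>j=1..r. m n j)
            * poly (map_poly complex_of_real (mult_laguerre1 r \<alpha> (m n))) (z / of_nat n ^ r)
            / of_real (\<Prod>j=1..r. pochhammer (?a j) (m n j))"
        unfolding D_def[symmetric] using D by simp
    qed
  qed
  ultimately show ?thesis
    by (simp only: uniform_limit_cong)
qed

end
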